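(* Let $n\geq 2$ and let $G\subset\mathbb{R}^n$ be an unbounded open convex set that does not contain a translation of a cone with non-empty interior. Let $\alpha\in(0,1)$ and set $\omega(t):=t^{\alpha}$ for all $t\geq 0$. Then there exists $f:G\to\mathbb{R}$ that is both $\omega$-semiconvex and $\omega$-semiconcave and such that $f\notin C^{1,\alpha}(G)$.
   Context: The norm $|\cdot|$ on $\mathbb{R}^n$ is Euclidean. A cone in $\mathbb{R}^n$ is a set $C\subset\mathbb{R}^n$ such that $\lambda x\in C$ for each $x\in C$ and $\lambda>0$. Let $G\subset\mathbb{R}^n$ be open and convex and let $\omega:[0,\infty)\to[0,\infty)$ be non-decreasing with $\lim_{h\to 0+}\omega(h)=0$. A function $f:G\to\mathbb{R}$ is $\omega$-semiconvex if $$f(\lambda x+(1-\lambda)y)\leq\lambda f(x)+(1-\lambda)f(y)+\lambda(1-\lambda)|x-y|\,\omega(|x-y|)$$ for every $x,y\in G$ and $\lambda\in[0,1]$. It is $\omega$-semiconcave if $-f$ is $\omega$-semiconvex. $C^{1,\alpha}(G)$ is the set of all Fréchet differentiable $f:G\to\mathbb{R}$ for which there is $C>0$ with $|f'(x)-f'(y)|\leq C|x-y|^{\alpha}$ for all $x,y\in G$, where $f'(x)$ is the Fréchet derivative of $f$ at $x$. *)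

theory Defs
  imports "HOL-Analysis.Analysis"
begin

text \<open>
  The library predicate \<^const>\<open>cone\<close> also demands closure under multiplication by 0;
  here only positive factors are required, so a cone need not contain the origin.
\<close>

definition pos_cone :: "'a::real_vector set \<Rightarrow> bool" where
  "pos_cone C \<longleftrightarrow> (\<forall>x\<in>C. \<forall>c>0. c *\<^sub>R x \<in> C)"

text \<open>
  A function on \<open>G\<close> is represented by a total function of which only the values on \<open>G\<close> matter.
  The standing hypotheses (\<open>G\<close> open and convex, \<open>\<omega>\<close> a non-decreasing map from
  \<open>[0,\<infinity>)\<close> to itself tending to 0 at 0) are left to the context of use.
\<close>

definition semiconvex_on ::
  "(real \<Rightarrow> real) \<Rightarrow> 'a::real_normed_vector set \<Rightarrow> ('a \<Rightarrow> real) \<Rightarrow> bool" where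
  "semiconvex_on \<omega> G f \<longleftrightarrow>
     (\<forall>x\<in>G. \<forall>y\<in>G. \<forall>l\<in>{0..1}.
        f (l *\<^sub>R x + (1 - l) *\<^sub>R y)
          \<le> l * f x + (1 - l) * f y + l * (1 - l) * norm (x - y) * \<omega> (norm (x - y)))"

definition semiconcave_on ::
  "(real \<Rightarrow> real) \<Rightarrow> 'a::real_normed_vector set \<Rightarrow> ('a \<Rightarrow> real) \<Rightarrow> bool" where
  "semiconcave_on \<omega> G f \<longleftrightarrow> semiconvex_on \<omega> G (\<lambda>x. - f x)"

text \<open>
  For open \<open>G\<close>, differentiability and the derivative at a point of \<open>G\<close> depend only on the values
  of \<open>f\<close> on \<open>G\<close>. The difference of derivatives is measured in the operator norm.
\<close>

definition C1_Holder :: "real \<Rightarrow> 'a::real_normed_vector set \<Rightarrow> ('a \<Rightarrow> real) set" where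
  "C1_Holder \<alpha> G =
     {f. (\<forall>x\<in>G. f differentiable (at x)) \<and>
         (\<exists>C>0. \<forall>x\<in>G. \<forall>y\<in>G.
            onorm (\<lambda>v. frechet_derivative f (at x) v - frechet_derivative f (at y) v)
              \<le> C * norm (x - y) powr \<alpha>)}"

end

theory Submission
  imports Defs
begin

text \<open>
  The obstruction to Hoelder continuity of the derivative is that \<open>G\<close> is thin. Its recession cone
  is convex and, since \<open>G\<close> contains a translate of it, has empty interior; hence it lies in a
  hyperplane with some unit normal \<open>u\<close>. By compactness of the unit sphere \<open>G\<close> contains a whole ray
  in some unit direction \<open>e\<close> orthogonal to \<open>u\<close>, while \<open>\<bar>u \<bullet> x\<bar>\<close> is \<open>o(\<bar>x\<bar>)\<close> on \<open>G\<close>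
  (\<open>flat_direction\<close>). Move the origin to a point of \<open>G\<close>.

  Let \<open>S\<^sub>K x = sqrt (\<bar>x\<bar>\<^sup>2 + K\<^sup>2)\<close> and \<open>b\<^sub>K x = (u \<bullet> x) * S\<^sub>K x powr \<alpha>\<close>. This function is
  homogeneous of degree \<open>1 + \<alpha>\<close> in \<open>(x, K)\<close>, so on the whole space its semiconvexity constant would not
  depend on \<open>K\<close>. On \<open>G\<close> the flatness makes \<open>\<bar>u \<bullet> x\<bar> \<le> \<eta> * S\<^sub>K x\<close> with \<open>\<eta>\<close> arbitrarily small once
  \<open>K\<close> is large, and the constant then becomes as small as desired (\<open>exists_small_block\<close>): for points
  at a distance \<open>d\<close> that is small compared with \<open>S\<^sub>K\<close> the second order behaviour of \<open>b\<^sub>K\<close> gives a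
  bound \<open>d\<^sup>2 * S\<^sub>K powr (\<alpha> - 1)\<close>, much smaller than \<open>d powr (1 + \<alpha>)\<close>, and for the other points the
  factor \<open>\<eta>\<close> wins. Yet the derivative of \<open>b\<^sub>K\<close> in direction \<open>u\<close> grows like \<open>t powr \<alpha>\<close> along
  \<open>t *\<^sub>R e\<close>, with coefficient \<open>1\<close> whatever \<open>K\<close> is.

  Hence choose \<open>K k\<close> so that the \<open>k\<close>-th block has constant at most \<open>4 powr (- k) / 2\<close>, and add up the
  blocks with weights \<open>2 ^ k\<close>. The sum satisfies the required inequality with constant \<open>1\<close>, while its
  derivative in direction \<open>u\<close> grows along the ray faster than every multiple of \<open>t powr \<alpha>\<close>. Subtracting
  the constant \<open>K powr \<alpha>\<close> from \<open>S\<^sub>K powr \<alpha>\<close> changes a block by a linear function only and makes the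
  series converge.
\<close>

section \<open>Recession directions\<close>

definition recession_cone :: "'a::real_vector set \<Rightarrow> 'a set" where
  "recession_cone G = {v. \<forall>x\<in>G. \<forall>t\<ge>0. x + t *\<^sub>R v \<in> G}"

lemma convex_recession_cone: "convex (recession_cone G)"
proof (rule convexI)
  fix v w :: 'a and a b :: real
  assume v: "v \<in> recession_cone G" and w: "w \<in> recession_cone G"
    and ab: "0 \<le> a" "0 \<le> b"
  have "x + t *\<^sub>R (a *\<^sub>R v + b *\<^sub>R w) \<in> G" if "x \<in> G" "t \<ge> 0" for x t
  proof -
    have "x + (t * a) *\<^sub>R v \<in> G"
      using v that ab by (simp add: recession_cone_def)
    then have "(x + (t * a) *\<^sub>R v) + (t * b) *\<^sub>R w \<in> G"
      using w that ab by (simp add: recession_cone_def)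
    then show ?thesis by (simp add: scaleR_add_right add.assoc)
  qed
  then show "a *\<^sub>R v + b *\<^sub>R w \<in> recession_cone G"
    by (simp add: recession_cone_def)
qed

lemma pos_cone_recession_cone: "pos_cone (recession_cone G)"
  by (auto simp: pos_cone_def recession_cone_def)

text \<open>
  The point \<open>x + t *\<^sub>R v\<close> is a convex combination of the far point \<open>X k\<close>, with the small weight
  \<open>t / norm (X k - p)\<close>, and a point \<open>y k\<close> that converges to \<open>x\<close> and so lies in the open set \<open>G\<close>
  eventually.
\<close>

lemma limit_direction_in_recession_cone:
  fixes G :: "'a::real_normed_vector set"
  assumes "open G" "convex G" and X: "\<And>k. X k \<in> G"
    and inf: "filterlim (\<lambda>k. norm (X k - p)) at_top sequentially"
    and lim: "(\<lambda>k. (X k - p) /\<^sub>R norm (X k - p)) \<longlonglongrightarrow> v"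
  shows "v \<in> recession_cone G"
proof -
  have "x + t *\<^sub>R v \<in> G" if "x \<in> G" "t \<ge> 0" for x t
  proof -
    define s where "s k = t / norm (X k - p)" for k
    have s0: "s \<longlonglongrightarrow> 0"
      unfolding s_def using inf by (intro tendsto_divide_0[OF tendsto_const] filterlim_at_top_imp_at_infinity)
    define y where "y k = (x + t *\<^sub>R v - s k *\<^sub>R p - t *\<^sub>R ((X k - p) /\<^sub>R norm (X k - p))) /\<^sub>R (1 - s k)" for k
    have "y \<longlonglongrightarrow> (x + t *\<^sub>R v - 0 *\<^sub>R p - t *\<^sub>R v) /\<^sub>R (1 - 0)"
      unfolding y_def by (intro tendsto_intros s0 lim) auto
    then have "y \<longlonglongrightarrow> x" by simp
    then have "eventually (\<lambda>k. y k \<in> G) sequentially"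
      using \<open>open G\<close> \<open>x \<in> G\<close> by (simp add: topological_tendstoD)
    moreover have "eventually (\<lambda>k. s k < 1) sequentially"
      using s0 by (simp add: order_tendstoD)
    moreover have "eventually (\<lambda>k. norm (X k - p) > 0) sequentially"
      using inf unfolding filterlim_at_top_dense by blast
    ultimately have "eventually (\<lambda>k. y k \<in> G \<and> s k < 1 \<and> norm (X k - p) > 0) sequentially"
      by eventually_elim auto
    then obtain k where k: "y k \<in> G" "s k < 1" "norm (X k - p) > 0"
      using eventually_happens'[OF sequentially_bot] by blast
    have "s k \<ge> 0" using that by (simp add: s_def)
    then have "(1 - s k) *\<^sub>R y k + s k *\<^sub>R X k \<in> G"
      using k X[of k] \<open>convex G\<close> by (intro convexD) auto
    also have "(1 - s k) *\<^sub>R y k = x + t *\<^sub>R v - s k *\<^sub>R p - s k *\<^sub>R (X k - p)"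
      using k by (simp add: y_def s_def divide_inverse)
    finally show ?thesis by (simp add: algebra_simps)
  qed
  then show ?thesis by (simp add: recession_cone_def)
qed

lemma unbounded_sequence_has_recession_direction:
  fixes G :: "'a::euclidean_space set"
  assumes "open G" "convex G" and X: "\<And>k. X k \<in> G"
    and big: "\<And>k. norm (X k - p) > real k"
  obtains v r where "v \<in> recession_cone G" "norm v = 1" "strict_mono r"
    "(\<lambda>k. (X (r k) - p) /\<^sub>R norm (X (r k) - p)) \<longlonglongrightarrow> v"
proof -
  have pos: "norm (X k - p) > 0" for k
    using big[of k] by (meson le_less_trans of_nat_0_le_iff)
  have "seq_compact (sphere (0::'a) 1)"
    using compact_imp_seq_compact compact_sphere by blast
  moreover have "\<forall>k. (X k - p) /\<^sub>R norm (X k - p) \<in> sphere 0 1"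
    using pos by auto
  ultimately obtain v r where v: "v \<in> sphere 0 1" and r: "strict_mono r"
    and lim: "((\<lambda>k. (X k - p) /\<^sub>R norm (X k - p)) \<circ> r) \<longlonglongrightarrow> v"
    by (rule seq_compactE)
  have "filterlim (\<lambda>k. norm (X k - p)) at_top sequentially"
    by (rule filterlim_at_top_mono[OF filterlim_real_sequentially])
      (simp add: big less_imp_le)
  then have "filterlim (\<lambda>k. norm (X (r k) - p)) at_top sequentially"
    using filterlim_compose filterlim_subseq[OF r] by blast
  then have "v \<in> recession_cone G"
    using lim by (intro limit_direction_in_recession_cone[where X = "X \<circ> r" and p = p] assms)
      (auto simp: o_def X)
  then show ?thesis
    using that v r lim by (simp add: o_def)
qed

text \<open>
  If the component along \<open>u\<close> were not \<open>o(norm (x - p))\<close>, some limit direction of \<open>G\<close> would have a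
  nonzero component along \<open>u\<close>; but limit directions belong to the recession cone, which is
  orthogonal to \<open>u\<close>.
\<close>

lemma flat_direction:
  fixes G :: "'a::euclidean_space set"
  assumes G: "open G" "convex G" "\<not> bounded G" and p: "p \<in> G"
    and no_cone: "\<not> (\<exists>C v. pos_cone C \<and> interior C \<noteq> {} \<and> (+) v ` C \<subseteq> G)"
  obtains e u where "norm e = 1" "norm u = 1" "u \<bullet> e = 0" "e \<in> recession_cone G"
    "\<And>\<epsilon>. \<epsilon> > 0 \<Longrightarrow> \<exists>M. \<forall>x\<in>G. \<bar>u \<bullet> (x - p)\<bar> \<le> \<epsilon> * norm (x - p) + M"
proof -
  have "(+) p ` recession_cone G \<subseteq> G"
    using p by (auto simp: recession_cone_def dest!: bspec[OF _ p] spec[where x = "1::real"])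
  then have "interior (recession_cone G) = {}"
    using no_cone pos_cone_recession_cone by blast
  then obtain a b where a: "a \<noteq> 0" and ab: "recession_cone G \<subseteq> {x. a \<bullet> x = b}"
    using empty_interior_subset_hyperplane[OF convex_recession_cone] by metis
  have "0 \<in> recession_cone G" by (simp add: recession_cone_def)
  then have "b = 0" using ab by auto
  define u where "u = a /\<^sub>R norm a"
  have u: "norm u = 1" using a by (simp add: u_def)
  have ortho: "u \<bullet> v = 0" if "v \<in> recession_cone G" for v
    using ab that \<open>b = 0\<close> by (auto simp: u_def)
  have "\<exists>x. x \<in> G \<and> norm (x - p) > real k" for k
  proof (rule ccontr)
    assume "\<not> ?thesis"
    then have "G \<subseteq> cball p (real k)"
      by (auto simp: dist_norm norm_minus_commute not_less)
    then show False using G bounded_subset bounded_cball by blast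
  qed
  then obtain X where "\<And>k. X k \<in> G" "\<And>k. norm (X k - p) > real k"
    by metis
  then obtain e where e: "e \<in> recession_cone G" "norm e = 1"
    by (meson unbounded_sequence_has_recession_direction G)
  have "\<exists>M. \<forall>x\<in>G. \<bar>u \<bullet> (x - p)\<bar> \<le> \<epsilon> * norm (x - p) + M" if "\<epsilon> > 0" for \<epsilon>
  proof (rule ccontr)
    assume "\<not> ?thesis"
    then have "\<forall>k. \<exists>x\<in>G. \<bar>u \<bullet> (x - p)\<bar> > \<epsilon> * norm (x - p) + real k"
      by (meson not_less)
    then obtain X where X: "\<And>k. X k \<in> G"
      and big: "\<And>k. \<bar>u \<bullet> (X k - p)\<bar> > \<epsilon> * norm (X k - p) + real k"
      by metis
    have far: "norm (X k - p) > real k" for k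
    proof -
      have "\<epsilon> * norm (X k - p) \<ge> 0" using that by simp
      moreover have "\<bar>u \<bullet> (X k - p)\<bar> \<le> norm (X k - p)"
        using Cauchy_Schwarz_ineq2[of u "X k - p"] u by simp
      ultimately show ?thesis using big[of k] by linarith
    qed
    obtain v r where v: "v \<in> recession_cone G" and r: "strict_mono r"
      and lim: "(\<lambda>k. (X (r k) - p) /\<^sub>R norm (X (r k) - p)) \<longlonglongrightarrow> v"
      using unbounded_sequence_has_recession_direction[OF G(1,2) X far] by metis
    have "\<bar>u \<bullet> ((X k - p) /\<^sub>R norm (X k - p))\<bar> \<ge> \<epsilon>" for k
    proof -
      have "norm (X k - p) > 0" using far[of k] by (meson le_less_trans of_nat_0_le_iff)
      moreover have "\<bar>u \<bullet> (X k - p)\<bar> \<ge> \<epsilon> * norm (X k - p)"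
        using big[of k] of_nat_0_le_iff[of k, where ?'a = real] by linarith
      ultimately have "\<epsilon> \<le> \<bar>u \<bullet> (X k - p)\<bar> / norm (X k - p)"
        by (simp add: pos_le_divide_eq)
      then show ?thesis by (simp add: abs_mult divide_inverse mult.commute)
    qed
    moreover have "(\<lambda>k. \<bar>u \<bullet> ((X (r k) - p) /\<^sub>R norm (X (r k) - p))\<bar>) \<longlonglongrightarrow> \<bar>u \<bullet> v\<bar>"
      by (intro tendsto_intros lim)
    ultimately have "\<epsilon> \<le> \<bar>u \<bullet> v\<bar>"
      by (intro LIMSEQ_le_const) auto
    then show False using ortho[OF v] that by simp
  qed
  then show ?thesis using that e u ortho by blast
qed

section \<open>Chord gaps\<close>

text \<open>
  With the deviation from affinity as a linear operator on functions, semiconvexity and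
  semiconcavity together become one bound on an absolute value, which is stable under sums.
\<close>

definition chord_gap :: "('a::real_vector \<Rightarrow> real) \<Rightarrow> real \<Rightarrow> 'a \<Rightarrow> 'a \<Rightarrow> real" where
  "chord_gap f l x y = l * f x + (1 - l) * f y - f (l *\<^sub>R x + (1 - l) *\<^sub>R y)"

lemma semiconvex_and_semiconcave_if_chord_gap_le:
  assumes "\<And>x y l. x \<in> G \<Longrightarrow> y \<in> G \<Longrightarrow> l \<in> {0..1} \<Longrightarrow>
    \<bar>chord_gap f l x y\<bar> \<le> l * (1 - l) * norm (x - y) * \<omega> (norm (x - y))"
  shows "semiconvex_on \<omega> G f" "semiconcave_on \<omega> G f"
proof -
  have "f (l *\<^sub>R x + (1 - l) *\<^sub>R y)
      \<le> l * f x + (1 - l) * f y + l * (1 - l) * norm (x - y) * \<omega> (norm (x - y))"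
    and "- f (l *\<^sub>R x + (1 - l) *\<^sub>R y)
      \<le> l * - f x + (1 - l) * - f y + l * (1 - l) * norm (x - y) * \<omega> (norm (x - y))"
    if "x \<in> G" "y \<in> G" "l \<in> {0..1}" for x y l
    using assms[OF that] unfolding chord_gap_def mult_minus_right by linarith+
  then show "semiconvex_on \<omega> G f" "semiconcave_on \<omega> G f"
    by (simp_all add: semiconvex_on_def semiconcave_on_def)
qed

text \<open>
  A Leibniz rule. The constant \<open>c\<close> drops out because it contributes a linear function. Both terms
  on the right come with a factor that is small on flat sets, \<open>L\<close> at the intermediate point and
  \<open>L (x - y)\<close>.
\<close>

lemma chord_gap_linear_mult:
  assumes "linear L"
  shows "chord_gap (\<lambda>x. L x * (h x - c)) l x y =
    L (l *\<^sub>R x + (1 - l) *\<^sub>R y) * chord_gap h l x y + l * (1 - l) * L (x - y) * (h x - h y)"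
proof -
  have lin: "L (l *\<^sub>R x + (1 - l) *\<^sub>R y) = l * L x + (1 - l) * L y" "L (x - y) = L x - L y"
    using assms by (simp_all add: linear_add linear_scale linear_diff)
  show ?thesis
    unfolding chord_gap_def lin by (simp only: ring_distribs mult_ac)
qed

section \<open>Powers\<close>

text \<open>
  The mean value theorem would give the derivative at the smaller argument; the larger one may be
  used here because \<open>a * b powr (\<alpha> - 1) \<le> a powr \<alpha>\<close>. This makes the estimate useful even when \<open>a\<close>
  is tiny compared with \<open>b\<close>.
\<close>

lemma powr_diff_le_max:
  fixes a b \<alpha> :: real
  assumes "0 < a" "a \<le> b" "0 < \<alpha>" "\<alpha> \<le> 1"
  shows "\<bar>b powr \<alpha> - a powr \<alpha>\<bar> \<le> (b - a) * b powr (\<alpha> - 1)"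
proof -
  have "a * b powr (\<alpha> - 1) \<le> a * a powr (\<alpha> - 1)"
    using assms by (intro mult_left_mono powr_mono2') auto
  also have "\<dots> = a powr \<alpha>"
    using assms by (simp add: powr_mult_base)
  finally have "a * b powr (\<alpha> - 1) \<le> a powr \<alpha>" .
  moreover have "b * b powr (\<alpha> - 1) = b powr \<alpha>"
    using assms by (simp add: powr_mult_base)
  moreover have "a powr \<alpha> \<le> b powr \<alpha>"
    using assms by (intro powr_mono2) auto
  ultimately show ?thesis by (simp add: algebra_simps)
qed

text \<open>
  Taylor's formula with a remainder bound that is uniform in the ratio of \<open>p\<close> and \<open>q\<close>. After
  scaling to \<open>s = q / p\<close> the upper bound is Young's inequality, and the lower one comes from the
  tangent of the convex function \<open>s powr (\<beta> - 1)\<close> at \<open>1\<close>, multiplied by \<open>s\<close>.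
\<close>

lemma powr_taylor_bound:
  fixes p q \<beta> :: real
  assumes "0 < p" "0 < q" "0 < \<beta>" "\<beta> < 1"
  shows "\<bar>q powr \<beta> - p powr \<beta> - \<beta> * p powr (\<beta> - 1) * (q - p)\<bar> \<le> p powr (\<beta> - 2) * (q - p)\<^sup>2"
proof -
  define s where "s = q / p"
  have s: "s > 0" "q = p * s" using assms by (simp_all add: s_def)
  have upper: "s powr \<beta> \<le> 1 + \<beta> * (s - 1)"
    using Youngs_inequality_0[of \<beta> "1 - \<beta>" s 1] assms s by (simp add: algebra_simps)
  have "1 - (1 - \<beta>) * (s - 1) \<le> 1 - (1 - \<beta>) * ln s"
    using ln_le_minus_one[OF s(1)] assms by (simp add: mult_left_mono)
  also have "\<dots> \<le> exp (- (1 - \<beta>) * ln s)"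
    using exp_ge_add_one_self[of "- (1 - \<beta>) * ln s"] by linarith
  also have "\<dots> = s powr (\<beta> - 1)"
    using s by (simp add: powr_def)
  finally have "s * (1 - (1 - \<beta>) * (s - 1)) \<le> s * s powr (\<beta> - 1)"
    using s by (intro mult_left_mono) auto
  also have "\<dots> = s powr \<beta>"
    using s by (simp add: powr_mult_base)
  finally have lower: "s powr \<beta> \<ge> 1 + \<beta> * (s - 1) - (1 - \<beta>) * (s - 1)\<^sup>2"
    by (simp add: algebra_simps power2_eq_square)
  have "(1 - \<beta>) * (s - 1)\<^sup>2 \<le> (s - 1)\<^sup>2"
    using assms by (simp add: mult_left_le_one_le)
  then have main: "\<bar>s powr \<beta> - 1 - \<beta> * (s - 1)\<bar> \<le> (s - 1)\<^sup>2"
    using upper lower zero_le_power2[of "s - 1"] by linarith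
  have e1: "p powr (\<beta> - 1) * p = p powr \<beta>"
    using assms by (simp add: powr_mult_base mult.commute)
  have "p powr (\<beta> - 2) * p ^ 2 = p powr (\<beta> - 2) * p powr 2"
    using assms by simp
  also have "\<dots> = p powr \<beta>"
    by (simp flip: powr_add)
  finally have e2: "p powr (\<beta> - 2) * p ^ 2 = p powr \<beta>" .
  have "q powr \<beta> - p powr \<beta> - \<beta> * p powr (\<beta> - 1) * (q - p)
      = q powr \<beta> - p powr \<beta> - \<beta> * (p powr (\<beta> - 1) * p) * (s - 1)"
    by (simp add: s algebra_simps)
  also have "\<dots> = p powr \<beta> * s powr \<beta> - p powr \<beta> - \<beta> * p powr \<beta> * (s - 1)"
    unfolding e1 using assms s by (simp add: powr_mult)
  also have "\<dots> = p powr \<beta> * (s powr \<beta> - 1 - \<beta> * (s - 1))"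
    by (simp add: algebra_simps)
  finally have "\<bar>q powr \<beta> - p powr \<beta> - \<beta> * p powr (\<beta> - 1) * (q - p)\<bar>
      \<le> p powr \<beta> * (s - 1)\<^sup>2"
    using main by (simp add: abs_mult mult_left_mono)
  also have "\<dots> = p powr (\<beta> - 2) * (p ^ 2 * (s - 1)\<^sup>2)"
    by (simp flip: e2 add: mult.assoc)
  also have "p ^ 2 * (s - 1)\<^sup>2 = (q - p)\<^sup>2"
    by (simp add: s algebra_simps power2_eq_square)
  finally show ?thesis .
qed

section \<open>The building block\<close>

text \<open>
  The function \<open>sqrt (\<bar>x\<bar>\<^sup>2 + K\<^sup>2)\<close>. Written as the norm of a pair, it is visibly convex and
  1-Lipschitz in \<open>x\<close>.
\<close>

definition smooth_norm :: "real \<Rightarrow> 'a::real_inner \<Rightarrow> real" where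
  "smooth_norm K x = norm (x, K)"

lemma smooth_norm_power2: "(smooth_norm K x)\<^sup>2 = x \<bullet> x + K\<^sup>2"
  by (simp add: smooth_norm_def norm_Pair power2_norm_eq_inner)

lemma norm_le_smooth_norm: "norm x \<le> smooth_norm K x"
  by (simp add: smooth_norm_def norm_Pair)

lemma abs_le_smooth_norm: "\<bar>K\<bar> \<le> smooth_norm K x"
  by (simp add: smooth_norm_def norm_Pair real_le_rsqrt)

lemma smooth_norm_pos: "0 < K \<Longrightarrow> 0 < smooth_norm K x"
  using abs_le_smooth_norm[of K x] by linarith

lemma smooth_norm_lipschitz: "\<bar>smooth_norm K x - smooth_norm K y\<bar> \<le> norm (x - y)"
  using norm_triangle_ineq3[of "(x, K)" "(y, K)"] by (simp add: smooth_norm_def norm_Pair)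

lemma smooth_norm_convex:
  assumes "0 \<le> l" "l \<le> 1" "smooth_norm K x \<le> M" "smooth_norm K y \<le> M"
  shows "smooth_norm K (l *\<^sub>R x + (1 - l) *\<^sub>R y) \<le> M"
proof -
  have "(l *\<^sub>R x + (1 - l) *\<^sub>R y, K) = l *\<^sub>R (x, K) + (1 - l) *\<^sub>R (y, K)"
    by (simp add: algebra_simps)
  then have "smooth_norm K (l *\<^sub>R x + (1 - l) *\<^sub>R y) \<le> l * smooth_norm K x + (1 - l) * smooth_norm K y"
    unfolding smooth_norm_def
    using norm_triangle_ineq[of "l *\<^sub>R (x, K)" "(1 - l) *\<^sub>R (y, K)"] assms(1,2)
    by (simp del: scaleR_Pair)
  also have "\<dots> \<le> M"
    using assms by (intro convex_bound_le) auto
  finally show ?thesis .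
qed

lemma smooth_norm_powr_diff:
  assumes "0 < K" "0 < \<alpha>" "\<alpha> \<le> 1"
  shows "\<bar>smooth_norm K x powr \<alpha> - smooth_norm K y powr \<alpha>\<bar>
    \<le> norm (x - y) * (max (smooth_norm K x) (smooth_norm K y)) powr (\<alpha> - 1)"
proof -
  have *: "\<bar>smooth_norm K x powr \<alpha> - smooth_norm K y powr \<alpha>\<bar>
    \<le> norm (x - y) * (smooth_norm K x) powr (\<alpha> - 1)"
    if "smooth_norm K y \<le> smooth_norm K x" for x y :: 'a
  proof -
    have "\<bar>smooth_norm K x powr \<alpha> - smooth_norm K y powr \<alpha>\<bar>
      \<le> (smooth_norm K x - smooth_norm K y) * smooth_norm K x powr (\<alpha> - 1)"
      using that assms by (intro powr_diff_le_max smooth_norm_pos) auto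
    also have "\<dots> \<le> norm (x - y) * (smooth_norm K x) powr (\<alpha> - 1)"
      using smooth_norm_lipschitz[of K x y] by (intro mult_right_mono) auto
    finally show ?thesis .
  qed
  show ?thesis
    using *[of x y] *[of y x] by (cases "smooth_norm K y \<le> smooth_norm K x")
      (auto simp: max_def norm_minus_commute abs_minus_commute)
qed

lemma chord_gap_smooth_norm_power2:
  "chord_gap (\<lambda>x. (smooth_norm K x)\<^sup>2) l x y = l * (1 - l) * (norm (x - y))\<^sup>2"
  by (simp add: chord_gap_def smooth_norm_power2 power2_norm_eq_inner inner_simps
      inner_commute[of y x] algebra_simps)

lemma smooth_norm_power2_diff:
  assumes "smooth_norm K x \<le> M" "smooth_norm K y \<le> M"
  shows "((smooth_norm K x)\<^sup>2 - (smooth_norm K y)\<^sup>2)\<^sup>2 \<le> (norm (x - y))\<^sup>2 * (4 * M\<^sup>2)"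
proof -
  have pos: "smooth_norm K x \<ge> 0" "smooth_norm K y \<ge> 0" by (simp_all add: smooth_norm_def)
  have "\<bar>(smooth_norm K x)\<^sup>2 - (smooth_norm K y)\<^sup>2\<bar>
      = \<bar>smooth_norm K x - smooth_norm K y\<bar> * (smooth_norm K x + smooth_norm K y)"
    using pos by (simp add: power2_eq_square square_diff_square_factored abs_mult mult.commute)
  also have "\<dots> \<le> norm (x - y) * (2 * M)"
    using assms pos smooth_norm_lipschitz by (intro mult_mono) auto
  finally have "\<bar>(smooth_norm K x)\<^sup>2 - (smooth_norm K y)\<^sup>2\<bar>\<^sup>2 \<le> (norm (x - y) * (2 * M))\<^sup>2"
    by (intro power_mono) auto
  then show ?thesis by (simp add: power_mult_distrib)
qed

text \<open>
  With \<open>q\<close> the square of the smooth norm, expand \<open>q powr (\<alpha> / 2)\<close> at the intermediate point. The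
  linear term sees the chord gap of the quadratic \<open>q\<close>, which is explicit, and the remainders at
  \<open>x\<close> and \<open>y\<close>, weighted by \<open>l\<close> and \<open>1 - l\<close>, are quadratic in \<open>1 - l\<close> and in \<open>l\<close>, so that a factor
  \<open>l * (1 - l)\<close> comes out. The last hypothesis makes the smooth norm at that point comparable with \<open>M\<close>.
\<close>

lemma chord_gap_smooth_norm_powr:
  fixes x y :: "'a::real_inner"
  assumes "0 < K" "0 < \<alpha>" "\<alpha> < 1" "0 \<le> l" "l \<le> 1"
    and M: "smooth_norm K x \<le> M" "smooth_norm K y \<le> M"
    and Z: "M \<le> 2 * smooth_norm K (l *\<^sub>R x + (1 - l) *\<^sub>R y)"
  shows "\<bar>chord_gap (\<lambda>x. smooth_norm K x powr \<alpha>) l x y\<bar>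
    \<le> l * (1 - l) * (norm (x - y))\<^sup>2 * (80 * M powr (\<alpha> - 2))"
proof -
  define z where "z = l *\<^sub>R x + (1 - l) *\<^sub>R y"
  define q where "q w = (smooth_norm K w)\<^sup>2" for w :: 'a
  define D where "D = l * (1 - l) * (norm (x - y))\<^sup>2"
  have D: "D \<ge> 0" using assms by (simp add: D_def)
  have qpos: "q w > 0" for w
    using smooth_norm_pos[OF \<open>0 < K\<close>, of w] by (simp add: q_def)
  have zpos: "smooth_norm K z > 0" and Mpos: "M > 0"
    using smooth_norm_pos[OF \<open>0 < K\<close>, of z] smooth_norm_pos[OF \<open>0 < K\<close>, of x] M by auto
  have zM: "smooth_norm K z \<le> M"
    using assms unfolding z_def by (intro smooth_norm_convex)
  have qpowr: "q w powr b = smooth_norm K w powr (2 * b)" for w b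
    using smooth_norm_pos[OF \<open>0 < K\<close>, of w]
    by (simp add: q_def powr_powr flip: powr_numeral)
  have S: "smooth_norm K w powr \<alpha> = q w powr (\<alpha> / 2)" for w
    by (simp add: qpowr)
  define P where "P = q z powr (\<alpha> / 2 - 2)"
  have "P = smooth_norm K z powr (\<alpha> - 4)"
    by (simp add: P_def qpowr algebra_simps)
  also have "\<dots> \<le> (M / 2) powr (\<alpha> - 4)"
    using assms Mpos by (intro powr_mono2') (auto simp: z_def)
  also have "\<dots> = 2 powr (4 - \<alpha>) * M powr (\<alpha> - 4)"
    using Mpos powr_minus_divide[of 2 "\<alpha> - 4"] powr_minus_divide[of 2 "4 - \<alpha>"] by (simp add: powr_divide)
  also have "\<dots> \<le> 2 powr 4 * M powr (\<alpha> - 4)"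
    using assms by (intro mult_right_mono powr_mono) auto
  finally have P: "P \<le> 16 * M powr (\<alpha> - 4)" by simp
  have "M powr (\<alpha> - 4) * M\<^sup>2 = M powr (\<alpha> - 4) * M powr 2"
    using Mpos by simp
  also have "\<dots> = M powr (\<alpha> - 2)"
    by (simp flip: powr_add)
  finally have PM: "P * M\<^sup>2 \<le> 16 * M powr (\<alpha> - 2)"
    using mult_right_mono[OF P, of "M\<^sup>2"] by (simp add: mult.assoc)
  define R where "R w = q w powr (\<alpha> / 2) - q z powr (\<alpha> / 2)
      - \<alpha> / 2 * q z powr (\<alpha> / 2 - 1) * (q w - q z)" for w
  have R: "\<bar>R w\<bar> \<le> P * (norm (w - z))\<^sup>2 * (4 * M\<^sup>2)" if "smooth_norm K w \<le> M" for w
  proof -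
    have "\<bar>R w\<bar> \<le> P * (q w - q z)\<^sup>2"
      unfolding R_def P_def using assms by (intro powr_taylor_bound qpos) auto
    also have "\<dots> \<le> P * ((norm (w - z))\<^sup>2 * (4 * M\<^sup>2))"
      unfolding q_def using smooth_norm_power2_diff[OF that zM]
      by (intro mult_left_mono) (auto simp: P_def)
    finally show ?thesis by (simp add: mult.assoc)
  qed
  have "x - z = (1 - l) *\<^sub>R (x - y)" "y - z = (- l) *\<^sub>R (x - y)"
    by (simp_all add: z_def algebra_simps)
  then have nx: "(norm (x - z))\<^sup>2 = (1 - l)\<^sup>2 * (norm (x - y))\<^sup>2"
    and ny: "(norm (y - z))\<^sup>2 = l\<^sup>2 * (norm (x - y))\<^sup>2"
    by (simp_all add: power_mult_distrib)
  have "chord_gap (\<lambda>x. smooth_norm K x powr \<alpha>) l x y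
      = \<alpha> / 2 * q z powr (\<alpha> / 2 - 1) * chord_gap q l x y + l * R x + (1 - l) * R y"
    unfolding R_def chord_gap_def S z_def[symmetric]
    by (simp only: ring_distribs mult_ac)
  also have "chord_gap q l x y = D"
    using chord_gap_smooth_norm_power2[of K l x y] by (simp add: D_def q_def[abs_def])
  finally have gap: "chord_gap (\<lambda>x. smooth_norm K x powr \<alpha>) l x y
      = \<alpha> / 2 * q z powr (\<alpha> / 2 - 1) * D + l * R x + (1 - l) * R y" .
  have "q z powr (\<alpha> / 2 - 1) = P * q z"
    using qpos[of z] by (simp add: P_def powr_mult_base mult.commute)
  also have "\<dots> \<le> P * M\<^sup>2"
    using zM zpos by (intro mult_left_mono) (auto simp: q_def P_def power_mono)
  finally have "\<alpha> / 2 * q z powr (\<alpha> / 2 - 1) \<le> 1 * (P * M\<^sup>2)"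
    using assms by (intro mult_mono) auto
  then have "\<alpha> / 2 * q z powr (\<alpha> / 2 - 1) * D \<le> 1 * (P * M\<^sup>2) * D"
    using D by (rule mult_right_mono)
  moreover have "0 \<le> \<alpha> / 2 * q z powr (\<alpha> / 2 - 1) * D"
    using D assms by (intro mult_nonneg_nonneg) auto
  ultimately have t1: "\<bar>\<alpha> / 2 * q z powr (\<alpha> / 2 - 1) * D\<bar> \<le> (P * M\<^sup>2) * D"
    by linarith
  have "\<bar>l * R x\<bar> \<le> l * (P * ((1 - l)\<^sup>2 * (norm (x - y))\<^sup>2) * (4 * M\<^sup>2))"
    using R[OF M(1)] assms by (simp add: abs_mult mult_left_mono nx)
  moreover have "\<bar>(1 - l) * R y\<bar> \<le> (1 - l) * (P * (l\<^sup>2 * (norm (x - y))\<^sup>2) * (4 * M\<^sup>2))"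
    using R[OF M(2)] assms by (simp add: abs_mult mult_left_mono ny)
  moreover have "l * (P * ((1 - l)\<^sup>2 * (norm (x - y))\<^sup>2) * (4 * M\<^sup>2)) +
      (1 - l) * (P * (l\<^sup>2 * (norm (x - y))\<^sup>2) * (4 * M\<^sup>2)) = 4 * (P * M\<^sup>2) * D"
    by (simp add: D_def algebra_simps power2_eq_square)
  ultimately have "\<bar>chord_gap (\<lambda>x. smooth_norm K x powr \<alpha>) l x y\<bar> \<le> 5 * (P * M\<^sup>2) * D"
    unfolding gap using t1 by linarith
  also have "\<dots> \<le> 5 * (16 * M powr (\<alpha> - 2)) * D"
    using PM D by (intro mult_right_mono) auto
  finally show ?thesis by (simp add: D_def mult.commute)
qed

text \<open>
  Let \<open>M\<close> be the larger smooth norm of the end points. If they are closer than \<open>\<theta> * M\<close>, then both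
  terms of the Leibniz rule are of second order and bounded by \<open>d\<^sup>2 * M powr (\<alpha> - 1)\<close>; this yields
  the factor \<open>\<theta> powr (1 - \<alpha>)\<close>. If they are farther apart, then first order bounds suffice: both
  terms contain a value of the functional \<open>u\<close> of modulus at most \<open>2 * \<eta> * M\<close>, and \<open>M\<close> is at most \<open>d / \<theta>\<close>.
\<close>

lemma chord_gap_block:
  fixes x y u :: "'a::real_inner"
  assumes "0 < K" "0 < \<alpha>" "\<alpha> < 1" "0 \<le> l" "l \<le> 1" "norm u = 1"
    and \<theta>: "0 < \<theta>" "\<theta> \<le> 1 / 2" and "0 \<le> \<eta>"
    and x: "\<bar>u \<bullet> x\<bar> \<le> \<eta> * smooth_norm K x" and y: "\<bar>u \<bullet> y\<bar> \<le> \<eta> * smooth_norm K y"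
    and z: "\<bar>u \<bullet> (l *\<^sub>R x + (1 - l) *\<^sub>R y)\<bar> \<le> \<eta> * smooth_norm K (l *\<^sub>R x + (1 - l) *\<^sub>R y)"
  shows "\<bar>chord_gap (\<lambda>x. (u \<bullet> x) * (smooth_norm K x powr \<alpha> - c)) l x y\<bar>
    \<le> (81 * \<theta> powr (1 - \<alpha>) + 4 * \<eta> * \<theta> powr (- \<alpha>)) * (l * (1 - l) * norm (x - y) * norm (x - y) powr \<alpha>)"
    (is "?lhs \<le> _")
proof -
  define w where "w = l *\<^sub>R x + (1 - l) *\<^sub>R y"
  define M where "M = max (smooth_norm K x) (smooth_norm K y)"
  define d where "d = norm (x - y)"
  define h where "h v = smooth_norm K v powr \<alpha>" for v :: 'a
  have M: "smooth_norm K x \<le> M" "smooth_norm K y \<le> M" by (simp_all add: M_def)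
  have wM: "smooth_norm K w \<le> M"
    using assms M unfolding w_def by (intro smooth_norm_convex)
  have Mpos: "M > 0" using smooth_norm_pos[OF \<open>0 < K\<close>, of x] M by auto
  have d0: "d \<ge> 0" by (simp add: d_def)
  have "x - w = (1 - l) *\<^sub>R (x - y)" "y - w = (- l) *\<^sub>R (x - y)"
    by (simp_all add: w_def algebra_simps)
  then have nw: "norm (x - w) = (1 - l) * d" "norm (y - w) = l * d"
    using assms by (simp_all add: d_def)
  have u1: "\<bar>u \<bullet> v\<bar> \<le> norm v" for v
    using Cauchy_Schwarz_ineq2[of u v] assms by simp
  have MM: "M * M powr (\<alpha> - 1) = M powr \<alpha>" "M * M powr (\<alpha> - 2) = M powr (\<alpha> - 1)"
    using Mpos by (simp_all add: powr_mult_base)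
  have hxy: "\<bar>h x - h y\<bar> \<le> d * M powr (\<alpha> - 1)"
    using smooth_norm_powr_diff[of K \<alpha> x y] assms by (simp add: h_def d_def M_def)
  have "?lhs = \<bar>(u \<bullet> w) * chord_gap h l x y + l * (1 - l) * (u \<bullet> (x - y)) * (h x - h y)\<bar>"
    using chord_gap_linear_mult[of "(\<bullet>) u" h c l x y]
    by (simp add: w_def h_def[abs_def] bounded_linear.linear bounded_linear_inner_right)
  also have "\<dots> \<le> \<bar>u \<bullet> w\<bar> * \<bar>chord_gap h l x y\<bar> + l * (1 - l) * (\<bar>u \<bullet> (x - y)\<bar> * \<bar>h x - h y\<bar>)"
    using assms by (intro order_trans[OF abs_triangle_ineq]) (simp add: abs_mult)
  also have "\<dots> \<le> (81 * \<theta> powr (1 - \<alpha>) + 4 * \<eta> * \<theta> powr (- \<alpha>)) * (l * (1 - l) * d * d powr \<alpha>)"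
  proof (cases "d \<le> \<theta> * M")
    case True
    have "M - smooth_norm K w \<le> d"
    proof -
      have "(1 - l) * d \<le> d" "l * d \<le> d"
        using assms d0 by (simp_all add: mult_left_le_one_le)
      then show ?thesis
        using nw smooth_norm_lipschitz[of K x w] smooth_norm_lipschitz[of K y w] by (auto simp: M_def)
    qed
    moreover have "\<theta> * M \<le> 1 / 2 * M"
      using \<theta> Mpos by (intro mult_right_mono) auto
    ultimately have "M \<le> 2 * smooth_norm K w" using True by linarith
    then have gap: "\<bar>chord_gap h l x y\<bar> \<le> l * (1 - l) * d\<^sup>2 * (80 * M powr (\<alpha> - 2))"
      unfolding h_def d_def w_def using assms M by (intro chord_gap_smooth_norm_powr) auto
    have "\<bar>u \<bullet> w\<bar> \<le> M"
      using u1[of w] norm_le_smooth_norm[of w K] wM by linarith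
    then have "\<bar>u \<bullet> w\<bar> * \<bar>chord_gap h l x y\<bar> \<le> M * (l * (1 - l) * d\<^sup>2 * (80 * M powr (\<alpha> - 2)))"
      using gap Mpos by (intro mult_mono) auto
    also have "\<dots> = 80 * (l * (1 - l)) * (d\<^sup>2 * M powr (\<alpha> - 1))"
      by (simp flip: MM(2) add: algebra_simps)
    finally have 1: "\<bar>u \<bullet> w\<bar> * \<bar>chord_gap h l x y\<bar> \<le> 80 * (l * (1 - l)) * (d\<^sup>2 * M powr (\<alpha> - 1))" .
    have "\<bar>u \<bullet> (x - y)\<bar> * \<bar>h x - h y\<bar> \<le> d * (d * M powr (\<alpha> - 1))"
      using hxy u1[of "x - y"] d0 by (intro mult_mono) (auto simp: d_def)
    then have 2: "l * (1 - l) * (\<bar>u \<bullet> (x - y)\<bar> * \<bar>h x - h y\<bar>) \<le> l * (1 - l) * (d\<^sup>2 * M powr (\<alpha> - 1))"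
      using assms by (intro mult_left_mono) (auto simp: power2_eq_square mult.assoc)
    have near: "d\<^sup>2 * M powr (\<alpha> - 1) \<le> \<theta> powr (1 - \<alpha>) * (d * d powr \<alpha>)"
    proof (cases "d = 0")
      case False
      then have dp: "d > 0" using d0 by simp
      have "M powr (\<alpha> - 1) \<le> (d / \<theta>) powr (\<alpha> - 1)"
        using True \<theta> dp assms by (intro powr_mono2') (auto simp: field_simps)
      also have "\<dots> = d powr (\<alpha> - 1) * \<theta> powr (1 - \<alpha>)"
        using dp \<theta> powr_minus_divide[of \<theta> "\<alpha> - 1"] by (simp add: powr_divide)
      finally have "d\<^sup>2 * M powr (\<alpha> - 1) \<le> d\<^sup>2 * (d powr (\<alpha> - 1) * \<theta> powr (1 - \<alpha>))"
        by (intro mult_left_mono) auto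
      also have "\<dots> = \<theta> powr (1 - \<alpha>) * (d * (d * d powr (\<alpha> - 1)))"
        by (simp add: power2_eq_square mult_ac)
      also have "d * d powr (\<alpha> - 1) = d powr \<alpha>"
        using dp by (simp add: powr_mult_base)
      finally show ?thesis .
    qed auto
    have "\<bar>u \<bullet> w\<bar> * \<bar>chord_gap h l x y\<bar> + l * (1 - l) * (\<bar>u \<bullet> (x - y)\<bar> * \<bar>h x - h y\<bar>)
        \<le> 81 * (l * (1 - l)) * (d\<^sup>2 * M powr (\<alpha> - 1))"
      using 1 2 by linarith
    also have "\<dots> \<le> 81 * (l * (1 - l)) * (\<theta> powr (1 - \<alpha>) * (d * d powr \<alpha>))"
      using near assms by (intro mult_left_mono) auto
    also have "\<dots> = (81 * \<theta> powr (1 - \<alpha>)) * (l * (1 - l) * d * d powr \<alpha>)"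
      by (simp add: mult_ac)
    also have "\<dots> \<le> (81 * \<theta> powr (1 - \<alpha>) + 4 * \<eta> * \<theta> powr (- \<alpha>)) * (l * (1 - l) * d * d powr \<alpha>)"
      using assms d0 by (intro mult_right_mono) auto
    finally show ?thesis .
  next
    case False
    \<comment> \<open>The smooth norm at \<open>w\<close> may be much smaller than \<open>M\<close>, so \<open>h\<close> need not have a Lipschitz constant
      of order \<open>M powr (\<alpha> - 1)\<close> there; the factor \<open>u \<bullet> w\<close> is then correspondingly small.\<close>
    have part: "\<bar>u \<bullet> w\<bar> * \<bar>h v - h w\<bar> \<le> \<eta> * norm (v - w) * M powr \<alpha>" if "smooth_norm K v \<le> M" for v
    proof -
      let ?m = "max (smooth_norm K v) (smooth_norm K w)"
      have m: "0 < ?m" "?m \<le> M" "smooth_norm K w \<le> ?m"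
        using that wM smooth_norm_pos[OF \<open>0 < K\<close>, of w] by auto
      have "\<bar>u \<bullet> w\<bar> \<le> \<eta> * smooth_norm K w" using z by (simp add: w_def)
      also have "\<dots> \<le> \<eta> * ?m" using m assms by (intro mult_left_mono) auto
      finally have "\<bar>u \<bullet> w\<bar> * \<bar>h v - h w\<bar> \<le> (\<eta> * ?m) * (norm (v - w) * ?m powr (\<alpha> - 1))"
        unfolding h_def using smooth_norm_powr_diff[of K \<alpha> v w] assms m by (intro mult_mono) auto
      also have "\<dots> = \<eta> * norm (v - w) * (?m * ?m powr (\<alpha> - 1))"
        by (simp only: mult_ac)
      also have "?m * ?m powr (\<alpha> - 1) = ?m powr \<alpha>"
        using m(1) by (simp add: powr_mult_base)
      also have "\<eta> * norm (v - w) * ?m powr \<alpha> \<le> \<eta> * norm (v - w) * M powr \<alpha>"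
        using m assms by (intro mult_left_mono powr_mono2) auto
      finally show ?thesis .
    qed
    have "chord_gap h l x y = l * (h x - h w) + (1 - l) * (h y - h w)"
      by (simp add: chord_gap_def w_def algebra_simps)
    then have "\<bar>chord_gap h l x y\<bar> \<le> l * \<bar>h x - h w\<bar> + (1 - l) * \<bar>h y - h w\<bar>"
      using assms by (auto intro!: order_trans[OF abs_triangle_ineq] simp: abs_mult)
    then have "\<bar>u \<bullet> w\<bar> * \<bar>chord_gap h l x y\<bar>
        \<le> \<bar>u \<bullet> w\<bar> * (l * \<bar>h x - h w\<bar> + (1 - l) * \<bar>h y - h w\<bar>)"
      by (intro mult_left_mono) auto
    also have "\<dots> = l * (\<bar>u \<bullet> w\<bar> * \<bar>h x - h w\<bar>) + (1 - l) * (\<bar>u \<bullet> w\<bar> * \<bar>h y - h w\<bar>)"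
      by (simp add: algebra_simps)
    also have "\<dots> \<le> l * (\<eta> * ((1 - l) * d) * M powr \<alpha>) + (1 - l) * (\<eta> * (l * d) * M powr \<alpha>)"
      using part[OF M(1)] part[OF M(2)] assms unfolding nw by (intro add_mono mult_left_mono) auto
    also have "\<dots> = 2 * \<eta> * (l * (1 - l) * d * M powr \<alpha>)"
      by (simp add: algebra_simps)
    finally have 1: "\<bar>u \<bullet> w\<bar> * \<bar>chord_gap h l x y\<bar> \<le> 2 * \<eta> * (l * (1 - l) * d * M powr \<alpha>)" .
    have "\<bar>u \<bullet> (x - y)\<bar> \<le> \<bar>u \<bullet> x\<bar> + \<bar>u \<bullet> y\<bar>"
      by (simp add: inner_diff_right)
    also have "\<dots> \<le> \<eta> * M + \<eta> * M"
      using x y M assms by (intro add_mono) (meson mult_left_mono order_trans)+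
    finally have "\<bar>u \<bullet> (x - y)\<bar> * \<bar>h x - h y\<bar> \<le> (\<eta> * M + \<eta> * M) * (d * M powr (\<alpha> - 1))"
      using hxy assms Mpos by (intro mult_mono) auto
    also have "\<dots> = 2 * \<eta> * (d * M powr \<alpha>)"
      by (simp flip: MM(1) add: algebra_simps)
    finally have "l * (1 - l) * (\<bar>u \<bullet> (x - y)\<bar> * \<bar>h x - h y\<bar>) \<le> l * (1 - l) * (2 * \<eta> * (d * M powr \<alpha>))"
      using assms by (intro mult_left_mono) auto
    also have "\<dots> = 2 * \<eta> * (l * (1 - l) * d * M powr \<alpha>)"
      by (simp add: mult_ac)
    finally have "\<bar>u \<bullet> w\<bar> * \<bar>chord_gap h l x y\<bar> + l * (1 - l) * (\<bar>u \<bullet> (x - y)\<bar> * \<bar>h x - h y\<bar>)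
        \<le> 4 * \<eta> * (l * (1 - l) * d * M powr \<alpha>)"
      using 1 by linarith
    also have "\<dots> \<le> 4 * \<eta> * (l * (1 - l) * d * (\<theta> powr (- \<alpha>) * d powr \<alpha>))"
    proof -
      have "M powr \<alpha> \<le> (d / \<theta>) powr \<alpha>"
        using False \<theta> Mpos assms by (intro powr_mono2) (auto simp: field_simps)
      also have "\<dots> = \<theta> powr (- \<alpha>) * d powr \<alpha>"
        using d0 \<theta> by (simp add: powr_divide powr_minus_divide)
      finally show ?thesis
        using assms d0 by (intro mult_left_mono) auto
    qed
    also have "\<dots> = (4 * \<eta> * \<theta> powr (- \<alpha>)) * (l * (1 - l) * d * d powr \<alpha>)"
      by (simp add: mult_ac)
    also have "\<dots> \<le> (81 * \<theta> powr (1 - \<alpha>) + 4 * \<eta> * \<theta> powr (- \<alpha>)) * (l * (1 - l) * d * d powr \<alpha>)"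
      using assms d0 by (intro mult_right_mono) auto
    finally show ?thesis .
  qed
  finally show ?thesis by (simp add: d_def)
qed

text \<open>
  Choose \<open>\<theta>\<close> to make the near contribution at most \<open>\<delta> / 2\<close>, then \<open>\<eta>\<close>, depending on \<open>\<theta>\<close>, to do the
  same for the far one, and finally \<open>K\<close> so large that it absorbs the constant \<open>M\<close> in the flatness
  estimate for \<open>\<epsilon> = \<eta> / 2\<close>.
\<close>

lemma exists_small_block:
  fixes A :: "'a::real_inner set"
  assumes "convex A" "norm u = 1" "0 < \<alpha>" "\<alpha> < 1" "0 < \<delta>"
    and flat: "\<And>\<epsilon>. \<epsilon> > 0 \<Longrightarrow> \<exists>M. \<forall>x\<in>A. \<bar>u \<bullet> x\<bar> \<le> \<epsilon> * norm x + M"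
  obtains K where "K \<ge> B" "K > 0"
    "\<And>x y l c. x \<in> A \<Longrightarrow> y \<in> A \<Longrightarrow> l \<in> {0..1} \<Longrightarrow>
      \<bar>chord_gap (\<lambda>x. (u \<bullet> x) * (smooth_norm K x powr \<alpha> - c)) l x y\<bar>
        \<le> \<delta> * (l * (1 - l) * norm (x - y) * norm (x - y) powr \<alpha>)"
proof -
  define \<theta> where "\<theta> = min (1 / 2) ((\<delta> / 162) powr (1 / (1 - \<alpha>)))"
  have \<theta>: "0 < \<theta>" "\<theta> \<le> 1 / 2" using assms by (simp_all add: \<theta>_def)
  have "\<theta> powr (1 - \<alpha>) \<le> ((\<delta> / 162) powr (1 / (1 - \<alpha>))) powr (1 - \<alpha>)"
    using \<theta> assms by (intro powr_mono2) (auto simp: \<theta>_def)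
  also have "\<dots> = \<delta> / 162" using assms by (simp add: powr_powr)
  finally have \<theta>\<delta>: "81 * \<theta> powr (1 - \<alpha>) \<le> \<delta> / 2" by simp
  define \<eta> where "\<eta> = \<delta> / 8 * \<theta> powr \<alpha>"
  have \<eta>: "\<eta> > 0" using assms \<theta> by (simp add: \<eta>_def)
  have \<eta>\<delta>: "4 * \<eta> * \<theta> powr (- \<alpha>) = \<delta> / 2"
    using \<theta> by (simp add: \<eta>_def powr_minus_divide)
  obtain M where M: "\<And>x. x \<in> A \<Longrightarrow> \<bar>u \<bullet> x\<bar> \<le> \<eta> / 2 * norm x + M"
    using flat[of "\<eta> / 2"] \<eta> by auto
  define K where "K = max (max B 1) (2 * M / \<eta>)"
  have K: "K \<ge> B" "K > 0" "M \<le> \<eta> / 2 * K"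
  proof -
    have "2 * M / \<eta> \<le> K" by (simp add: K_def)
    then show "M \<le> \<eta> / 2 * K" using \<eta> by (simp add: field_simps)
  qed (auto simp: K_def)
  have small: "\<bar>u \<bullet> x\<bar> \<le> \<eta> * smooth_norm K x" if "x \<in> A" for x
  proof -
    have "\<bar>u \<bullet> x\<bar> \<le> \<eta> / 2 * norm x + \<eta> / 2 * K"
      using M[OF that] K by linarith
    also have "\<dots> \<le> \<eta> / 2 * smooth_norm K x + \<eta> / 2 * smooth_norm K x"
      using norm_le_smooth_norm[of x K] abs_le_smooth_norm[of K x] \<eta>
      by (intro add_mono mult_left_mono) auto
    finally show ?thesis by simp
  qed
  show ?thesis
  proof (rule that[OF K(1,2)])
    fix x y l c assume *: "x \<in> A" "y \<in> A" "l \<in> {0..1::real}"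
    then have "l *\<^sub>R x + (1 - l) *\<^sub>R y \<in> A"
      using \<open>convex A\<close> by (intro convexD) auto
    then have "\<bar>chord_gap (\<lambda>x. (u \<bullet> x) * (smooth_norm K x powr \<alpha> - c)) l x y\<bar>
        \<le> (81 * \<theta> powr (1 - \<alpha>) + 4 * \<eta> * \<theta> powr (- \<alpha>)) * (l * (1 - l) * norm (x - y) * norm (x - y) powr \<alpha>)"
      using * \<theta> \<eta> K assms by (intro chord_gap_block small) auto
    also have "\<dots> \<le> \<delta> * (l * (1 - l) * norm (x - y) * norm (x - y) powr \<alpha>)"
      using \<theta>\<delta> \<eta>\<delta> * by (intro mult_right_mono) auto
    finally show "\<bar>chord_gap (\<lambda>x. (u \<bullet> x) * (smooth_norm K x powr \<alpha> - c)) l x y\<bar>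
        \<le> \<delta> * (l * (1 - l) * norm (x - y) * norm (x - y) powr \<alpha>)" .
  qed
qed

section \<open>A consequence of Hoelder continuity of the derivative\<close>

text \<open>
  The mean value theorem along two parallel segments. For the limit of a series this condition can be
  tested on values alone, without computing a derivative.
\<close>

lemma C1_Holder_second_difference:
  fixes f :: "'a::real_normed_vector \<Rightarrow> real"
  assumes "f \<in> C1_Holder \<alpha> G"
  shows "\<exists>C. \<forall>p q w. (\<forall>s\<in>{0..1}. p + s *\<^sub>R w \<in> G \<and> q + s *\<^sub>R w \<in> G) \<longrightarrow>
    \<bar>(f (p + w) - f p) - (f (q + w) - f q)\<bar> \<le> C * norm (p - q) powr \<alpha> * norm w"
proof -
  have diff: "(f has_derivative frechet_derivative f (at x)) (at x)" if "x \<in> G" for x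
    using assms that by (simp add: C1_Holder_def frechet_derivative_works)
  obtain C where C: "\<And>x y. x \<in> G \<Longrightarrow> y \<in> G \<Longrightarrow>
      onorm (\<lambda>v. frechet_derivative f (at x) v - frechet_derivative f (at y) v) \<le> C * norm (x - y) powr \<alpha>"
    using assms by (auto simp: C1_Holder_def)
  have "\<bar>(f (p + w) - f p) - (f (q + w) - f q)\<bar> \<le> C * norm (p - q) powr \<alpha> * norm w"
    if seg: "\<forall>s\<in>{0..1}. p + s *\<^sub>R w \<in> G \<and> q + s *\<^sub>R w \<in> G" for p q w
  proof -
    define D where "D x = frechet_derivative f (at x)" for x
    have line: "((\<lambda>s. f (a + s *\<^sub>R w)) has_derivative (\<lambda>t. D (a + s *\<^sub>R w) (t *\<^sub>R w))) (at s within {0..1})"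
      if "a + s *\<^sub>R w \<in> G" for a s
      unfolding D_def
      by (rule has_derivative_compose[where f = "\<lambda>s. a + s *\<^sub>R w"])
        (auto intro!: derivative_eq_intros diff that)
    have "\<exists>s\<in>{0<..<1}. (f (p + 1 *\<^sub>R w) - f (q + 1 *\<^sub>R w)) - (f (p + 0 *\<^sub>R w) - f (q + 0 *\<^sub>R w))
        = D (p + s *\<^sub>R w) ((1 - 0) *\<^sub>R w) - D (q + s *\<^sub>R w) ((1 - 0) *\<^sub>R w)"
    proof (rule mvt_simple)
      fix s :: real assume "0 \<le> s" "s \<le> 1"
      then have "p + s *\<^sub>R w \<in> G" "q + s *\<^sub>R w \<in> G" using seg by simp_all
      then show "((\<lambda>s. f (p + s *\<^sub>R w) - f (q + s *\<^sub>R w)) has_derivative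
          (\<lambda>t. D (p + s *\<^sub>R w) (t *\<^sub>R w) - D (q + s *\<^sub>R w) (t *\<^sub>R w))) (at s within {0..1})"
        by (intro has_derivative_diff line)
    qed simp
    then obtain s where s: "s \<in> {0<..<1}"
      and eq: "(f (p + w) - f q) - (f p - f q) - (f (q + w) - f q) = D (p + s *\<^sub>R w) w - D (q + s *\<^sub>R w) w"
      by (auto simp: algebra_simps)
    have G: "p + s *\<^sub>R w \<in> G" "q + s *\<^sub>R w \<in> G" using seg s by auto
    have "bounded_linear (\<lambda>v. D (p + s *\<^sub>R w) v - D (q + s *\<^sub>R w) v)"
      using diff G by (intro bounded_linear_sub) (auto simp: D_def has_derivative_bounded_linear)
    then have "norm (D (p + s *\<^sub>R w) w - D (q + s *\<^sub>R w) w)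
        \<le> onorm (\<lambda>v. D (p + s *\<^sub>R w) v - D (q + s *\<^sub>R w) v) * norm w"
      by (rule onorm)
    also have "\<dots> \<le> C * norm (p - q) powr \<alpha> * norm w"
      using C[OF G] by (intro mult_right_mono) (auto simp: D_def)
    finally show ?thesis using eq by simp
  qed
  then show ?thesis by (intro exI[of _ C] allI impI)
qed

section \<open>Superposition of the building blocks\<close>

text \<open>
  Since \<open>(S - K) * (S + K) = x \<bullet> x\<close> for the smooth norm \<open>S\<close>, the \<open>k\<close>-th term is at most
  \<open>2 ^ k * (x \<bullet> x) / K k\<close>.
\<close>

lemma summable_power2_smooth_norm_powr:
  assumes K: "\<And>k. K k \<ge> 4 ^ k" and \<alpha>: "0 < \<alpha>" "\<alpha> < 1"
  shows "summable (\<lambda>k. 2 ^ k * (smooth_norm (K k) x powr \<alpha> - K k powr \<alpha>))"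
proof (rule summable_comparison_test')
  show "summable (\<lambda>k. (x \<bullet> x) * (1 / 2) ^ k)"
    by (intro summable_mult summable_geometric) auto
  fix k :: nat
  have "K k \<ge> 1" using K[of k] one_le_power[of "4::real" k] by linarith
  define S where "S = smooth_norm (K k) x"
  have S: "S \<ge> K k" using abs_le_smooth_norm[of "K k" x] by (simp add: S_def)
  have "(S - K k) * K k \<le> (S - K k) * (S + K k)"
    using S \<open>K k \<ge> 1\<close> by (intro mult_left_mono) auto
  also have "\<dots> = x \<bullet> x"
    using smooth_norm_power2[of "K k" x] by (simp add: S_def algebra_simps power2_eq_square)
  finally have "S - K k \<le> (x \<bullet> x) / K k"
    using \<open>K k \<ge> 1\<close> by (simp add: pos_le_divide_eq)
  also have "\<dots> \<le> (x \<bullet> x) / 4 ^ k"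
    using K[of k] \<open>K k \<ge> 1\<close> by (intro divide_left_mono) auto
  finally have SK: "S - K k \<le> (x \<bullet> x) / 4 ^ k" .
  have "\<bar>S powr \<alpha> - K k powr \<alpha>\<bar> \<le> (S - K k) * S powr (\<alpha> - 1)"
    using S \<open>K k \<ge> 1\<close> \<alpha> by (intro powr_diff_le_max) auto
  also have "S powr (\<alpha> - 1) \<le> 1 powr (\<alpha> - 1)"
    using S \<open>K k \<ge> 1\<close> \<alpha> by (intro powr_mono2') auto
  then have "(S - K k) * S powr (\<alpha> - 1) \<le> (S - K k) * 1"
    using S by (intro mult_left_mono) auto
  finally have "\<bar>S powr \<alpha> - K k powr \<alpha>\<bar> \<le> (x \<bullet> x) / 4 ^ k"
    using SK by simp
  then have "2 ^ k * \<bar>S powr \<alpha> - K k powr \<alpha>\<bar> \<le> 2 ^ k * ((x \<bullet> x) / 4 ^ k)"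
    by (intro mult_left_mono) auto
  also have "\<dots> = (x \<bullet> x) * (1 / 2) ^ k"
    using power_mult_distrib[of "2::real" 2 k] by (simp add: power_divide field_simps)
  finally show "norm (2 ^ k * (smooth_norm (K k) x powr \<alpha> - K k powr \<alpha>)) \<le> (x \<bullet> x) * (1 / 2) ^ k"
    by (simp add: S_def abs_mult)
qed

lemma chord_gap_suminf_le:
  assumes sm: "\<And>x. summable (\<lambda>k. F k x)"
    and le: "\<And>k. \<bar>chord_gap (F k) l x y\<bar> \<le> (1 / 2) ^ Suc k * B"
  shows "\<bar>chord_gap (\<lambda>x. \<Sum>k. F k x) l x y\<bar> \<le> B"
proof -
  have gap: "(\<lambda>k. chord_gap (F k) l x y) sums chord_gap (\<lambda>x. \<Sum>k. F k x) l x y"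
    unfolding chord_gap_def
    by (intro sums_diff sums_add sums_mult summable_sums sm)
  have half: "(\<lambda>k. (1 / 2) ^ Suc k * B) sums (1 * B)"
    by (intro sums_mult2 power_half_series)
  have "chord_gap (F k) l x y \<le> (1 / 2) ^ Suc k * B" "- ((1 / 2) ^ Suc k * B) \<le> chord_gap (F k) l x y" for k
    using le[of k] by linarith+
  then have "chord_gap (\<lambda>x. \<Sum>k. F k x) l x y \<le> 1 * B"
    "- (1 * B) \<le> chord_gap (\<lambda>x. \<Sum>k. F k x) l x y"
    using sums_le[OF _ gap half] sums_le[OF _ sums_minus[OF half] gap] by blast+
  then show ?thesis by linarith
qed

section \<open>The counterexample\<close>

text \<open>
  To refute Hoelder continuity, compare the segment from \<open>p\<close> to \<open>p + r *\<^sub>R u\<close> with its translate by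
  \<open>t *\<^sub>R e\<close>. As \<open>f\<close> vanishes at \<open>p\<close> and at \<open>p + t *\<^sub>R e\<close>, the second difference is determined by the
  function \<open>H\<close>, the sum of the nonnegative \<open>g k\<close>, at \<open>r *\<^sub>R u\<close> and at \<open>t *\<^sub>R e + r *\<^sub>R u\<close>. A single
  \<open>g k\<close> with \<open>2 ^ k > C + 1\<close> already exceeds the permitted growth for large \<open>t\<close>.
\<close>

theorem theorem1p1:
  fixes G :: "(real ^ 'n) set" and \<alpha> :: real and \<omega> :: "real \<Rightarrow> real"
  assumes "CARD('n) \<ge> 2"
    and "open G" and "convex G" and "\<not> bounded G"
    and "\<not> (\<exists>C v. pos_cone C \<and> interior C \<noteq> {} \<and> (+) v ` C \<subseteq> G)"
    and "0 < \<alpha>" and "\<alpha> < 1"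
    and "\<And>t. t \<ge> 0 \<Longrightarrow> \<omega> t = t powr \<alpha>"
  shows "\<exists>f. semiconvex_on \<omega> G f \<and> semiconcave_on \<omega> G f \<and> f \<notin> C1_Holder \<alpha> G"
proof -
  obtain p where p: "p \<in> G" using \<open>\<not> bounded G\<close> by fastforce
  obtain e u where eu: "norm e = 1" "norm u = 1" "u \<bullet> e = 0" and e: "e \<in> recession_cone G"
    and flat: "\<And>\<epsilon>. \<epsilon> > 0 \<Longrightarrow> \<exists>M. \<forall>x\<in>G. \<bar>u \<bullet> (x - p)\<bar> \<le> \<epsilon> * norm (x - p) + M"
    using flat_direction[OF \<open>open G\<close> \<open>convex G\<close> \<open>\<not> bounded G\<close> p assms(5)] by metis
  define A where "A = (\<lambda>x. x - p) ` G"
  have "convex A"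
    unfolding A_def using \<open>convex G\<close> by (rule convex_translation_subtract)
  have flatA: "\<exists>M. \<forall>x\<in>A. \<bar>u \<bullet> x\<bar> \<le> \<epsilon> * norm x + M" if "\<epsilon> > 0" for \<epsilon>
    using flat[OF that] by (simp add: A_def)
  define good where "good k \<kappa> \<longleftrightarrow> \<kappa> \<ge> 4 ^ k \<and> \<kappa> > 0 \<and> (\<forall>x\<in>A. \<forall>y\<in>A. \<forall>l\<in>{0..1}. \<forall>c.
      \<bar>chord_gap (\<lambda>x. (u \<bullet> x) * (smooth_norm \<kappa> x powr \<alpha> - c)) l x y\<bar>
        \<le> (1 / 4) ^ k / 2 * (l * (1 - l) * norm (x - y) * norm (x - y) powr \<alpha>))"
    for k :: nat and \<kappa> :: real
  have "\<exists>\<kappa>. good k \<kappa>" for k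
  proof -
    have "(0::real) < (1 / 4) ^ k / 2" by simp
    show ?thesis
    proof (rule exists_small_block[OF \<open>convex A\<close> eu(2) \<open>0 < \<alpha>\<close> \<open>\<alpha> < 1\<close> \<open>(0::real) < (1 / 4) ^ k / 2\<close> flatA])
      fix \<kappa>
      assume "4 ^ k \<le> \<kappa>" "0 < \<kappa>" and
        *: "\<And>x y l c. x \<in> A \<Longrightarrow> y \<in> A \<Longrightarrow> l \<in> {0..1} \<Longrightarrow>
          \<bar>chord_gap (\<lambda>x. (u \<bullet> x) * (smooth_norm \<kappa> x powr \<alpha> - c)) l x y\<bar>
            \<le> (1 / 4) ^ k / 2 * (l * (1 - l) * norm (x - y) * norm (x - y) powr \<alpha>)"
      then have "good k \<kappa>"
        unfolding good_def by (intro conjI ballI allI *)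
      then show ?thesis ..
    qed
  qed
  then obtain K where good: "\<And>k. good k (K k)" by metis
  have K: "K k \<ge> 4 ^ k" "K k > 0" for k
    using good[of k] by (simp_all add: good_def)
  have block: "\<bar>chord_gap (\<lambda>x. (u \<bullet> x) * (smooth_norm (K k) x powr \<alpha> - c)) l x y\<bar>
      \<le> (1 / 4) ^ k / 2 * (l * (1 - l) * norm (x - y) * norm (x - y) powr \<alpha>)"
    if "x \<in> A" "y \<in> A" "l \<in> {0..1}" for k x y l c
    using good[of k] that unfolding good_def by blast
  define g where "g k x = 2 ^ k * (smooth_norm (K k) x powr \<alpha> - K k powr \<alpha>)" for k :: nat and x :: "real ^ 'n"
  define F where "F k x = (u \<bullet> (x - p)) * g k (x - p)" for k :: nat and x
  define f where "f x = (\<Sum>k. F k x)" for x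
  have sg: "summable (\<lambda>k. g k x)" for x
    unfolding g_def using K \<open>0 < \<alpha>\<close> \<open>\<alpha> < 1\<close> by (intro summable_power2_smooth_norm_powr) auto
  have sF: "summable (\<lambda>k. F k x)" for x
    unfolding F_def by (intro summable_mult sg)
  have f_eq: "f x = (u \<bullet> (x - p)) * (\<Sum>k. g k (x - p))" for x
    unfolding f_def F_def by (intro suminf_mult sg)
  have gap: "\<bar>chord_gap f l x y\<bar> \<le> l * (1 - l) * norm (x - y) * \<omega> (norm (x - y))"
    if xy: "x \<in> G" "y \<in> G" "l \<in> {0..1}" for x y l
  proof -
    let ?B = "l * (1 - l) * norm (x - y) * norm (x - y) powr \<alpha>"
    have "\<bar>chord_gap (F k) l x y\<bar> \<le> (1 / 2) ^ Suc k * ?B" for k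
    proof -
      have "l *\<^sub>R x + (1 - l) *\<^sub>R y - p = l *\<^sub>R (x - p) + (1 - l) *\<^sub>R (y - p)"
        by (simp add: algebra_simps)
      then have "chord_gap (F k) l x y
          = 2 ^ k * chord_gap (\<lambda>x. (u \<bullet> x) * (smooth_norm (K k) x powr \<alpha> - K k powr \<alpha>)) l (x - p) (y - p)"
        unfolding chord_gap_def F_def g_def by (simp only: ring_distribs mult_ac)
      moreover have "\<bar>chord_gap (\<lambda>x. (u \<bullet> x) * (smooth_norm (K k) x powr \<alpha> - K k powr \<alpha>)) l (x - p) (y - p)\<bar>
          \<le> (1 / 4) ^ k / 2 * ?B"
        using block[of "x - p" "y - p" l k] xy by (simp add: A_def)
      ultimately have "\<bar>chord_gap (F k) l x y\<bar> \<le> 2 ^ k * ((1 / 4) ^ k / 2 * ?B)"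
        by (simp add: abs_mult del: power_divide)
      also have "\<dots> = (2 * (1 / 4)) ^ k / 2 * ?B"
        unfolding power_mult_distrib by simp
      finally show ?thesis by simp
    qed
    then have "\<bar>chord_gap f l x y\<bar> \<le> ?B"
      unfolding f_def by (intro chord_gap_suminf_le sF)
    then show ?thesis using assms(8) by simp
  qed
  have "f \<notin> C1_Holder \<alpha> G"
  proof
    assume "f \<in> C1_Holder \<alpha> G"
    from C1_Holder_second_difference[OF this] obtain C
      where C: "\<forall>p q w. (\<forall>s\<in>{0..1}. p + s *\<^sub>R w \<in> G \<and> q + s *\<^sub>R w \<in> G) \<longrightarrow>
        \<bar>(f (p + w) - f p) - (f (q + w) - f q)\<bar> \<le> C * norm (p - q) powr \<alpha> * norm w"
      by (elim exE)
    obtain r where r: "r > 0" "cball p r \<subseteq> G"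
      using \<open>open G\<close> p open_contains_cball by blast
    define H where "H x = (\<Sum>k. g k x)" for x
    have bound: "H (t *\<^sub>R e + r *\<^sub>R u) \<le> H (r *\<^sub>R u) + C * t powr \<alpha>" if "t \<ge> 0" for t
    proof -
      have "\<forall>s\<in>{0..1}. p + s *\<^sub>R (r *\<^sub>R u) \<in> G \<and> (p + t *\<^sub>R e) + s *\<^sub>R (r *\<^sub>R u) \<in> G"
      proof
        fix s :: real assume "s \<in> {0..1}"
        then have "p + s *\<^sub>R (r *\<^sub>R u) \<in> cball p r"
          using r eu by (simp add: dist_norm mult_left_le_one_le)
        then have "p + s *\<^sub>R (r *\<^sub>R u) \<in> G" using r by blast
        moreover from this have "(p + s *\<^sub>R (r *\<^sub>R u)) + t *\<^sub>R e \<in> G"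
          using e \<open>t \<ge> 0\<close> unfolding recession_cone_def by blast
        ultimately show "p + s *\<^sub>R (r *\<^sub>R u) \<in> G \<and> (p + t *\<^sub>R e) + s *\<^sub>R (r *\<^sub>R u) \<in> G"
          by (simp add: add_ac)
      qed
      then have "\<bar>(f (p + r *\<^sub>R u) - f p) - (f (p + t *\<^sub>R e + r *\<^sub>R u) - f (p + t *\<^sub>R e))\<bar>
          \<le> C * norm (p - (p + t *\<^sub>R e)) powr \<alpha> * norm (r *\<^sub>R u)"
        using C by blast
      then have "\<bar>(f (p + r *\<^sub>R u) - f p) - (f (p + t *\<^sub>R e + r *\<^sub>R u) - f (p + t *\<^sub>R e))\<bar>
          \<le> C * t powr \<alpha> * r"
        using eu r \<open>t \<ge> 0\<close> by simp
      moreover have "u \<bullet> u = 1" using eu by (simp add: norm_eq_1)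
      then have "f (p + r *\<^sub>R u) = r * H (r *\<^sub>R u)" "f p = 0" "f (p + t *\<^sub>R e) = 0"
        "f (p + t *\<^sub>R e + r *\<^sub>R u) = r * H (t *\<^sub>R e + r *\<^sub>R u)"
        using eu by (simp_all add: f_eq H_def inner_add_right add.assoc)
      ultimately have "r * H (t *\<^sub>R e + r *\<^sub>R u) \<le> r * (H (r *\<^sub>R u) + C * t powr \<alpha>)"
        by (simp add: algebra_simps abs_le_iff)
      then show ?thesis using r by simp
    qed
    obtain k where k: "C + 1 < 2 ^ k"
      using real_arch_pow[of 2 "C + 1"] by auto
    \<comment> \<open>For every \<open>t\<close> one gets \<open>(2 ^ k - C) * t powr \<alpha> \<le> b\<close>; take \<open>t powr \<alpha> = b + 1\<close>.\<close>
    define b where "b = max 0 (H (r *\<^sub>R u) + 2 ^ k * K k powr \<alpha>)"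
    define t where "t = (b + 1) powr (1 / \<alpha>)"
    have t: "t powr \<alpha> = b + 1" "t \<ge> 0"
      using \<open>0 < \<alpha>\<close> by (simp_all add: t_def powr_powr b_def)
    define x where "x = t *\<^sub>R e + r *\<^sub>R u"
    have "t \<le> norm x"
    proof -
      have "e \<bullet> x = t" using eu by (simp add: x_def inner_add_right inner_commute[of e u] norm_eq_1)
      then show ?thesis using norm_cauchy_schwarz[of e x] eu by simp
    qed
    then have "t powr \<alpha> \<le> smooth_norm (K k) x powr \<alpha>"
      using norm_le_smooth_norm[of x "K k"] t \<open>0 < \<alpha>\<close> by (intro powr_mono2) auto
    then have "2 ^ k * (t powr \<alpha> - K k powr \<alpha>) \<le> g k x"
      unfolding g_def by (intro mult_left_mono) auto
    also have "g k x = (\<Sum>i\<in>{k}. g i x)" by simp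
    also have "\<dots> \<le> H x"
      unfolding H_def
    proof (rule sum_le_suminf[OF sg])
      show "0 \<le> g i x" for i
        unfolding g_def using abs_le_smooth_norm[of "K i" x] K(2)[of i] \<open>0 < \<alpha>\<close>
        by (intro mult_nonneg_nonneg) (auto intro!: powr_mono2)
    qed auto
    also have "\<dots> \<le> H (r *\<^sub>R u) + C * t powr \<alpha>"
      unfolding x_def by (rule bound[OF t(2)])
    finally have "(2 ^ k - C) * (b + 1) \<le> b"
      by (simp add: t(1) b_def algebra_simps)
    moreover have "1 * (b + 1) \<le> (2 ^ k - C) * (b + 1)"
      using k by (intro mult_right_mono) (auto simp: b_def)
    ultimately show False by simp
  qed
  with semiconvex_and_semiconcave_if_chord_gap_le[of G f \<omega>, OF gap]
  show ?thesis by blast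
qed

end
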